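(* Let $(X,\mu)$ be a finite measure space and let $f(\cdot\,;t)$, $t\in\mathbb R_+$, be a family of nonnegative $L^1$ functions on $X$ such that for every $x\in X$ the function $t\mapsto f(x;t)$ is nondecreasing. Set $F(t)=\int_X f(x;t)\,d\mu(x)$ and suppose $F(t)\to\infty$ as $t\to\infty$. Let $\varepsilon>0$ be arbitrary. 1. If $F(t)=O(t^p)$ for some $p>0$, then for almost every $x\in X$ we have $f(x;t)=O(t^{p+\varepsilon})$. 2. If $F(t)=O(e^{at})$ for some $a>0$, then for almost every $x\in X$ we have $f(x;t)=O(e^{(a+\varepsilon)t})$.
   Context: All $O(\cdot)$ bounds are as $t\to\infty$; the implied constants in the bounds for $f(x;t)$ may depend on $x$ and $\varepsilon$. *)

theory Defs
  imports "HOL-Analysis.Analysis" "HOL-Library.Landau_Symbols"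
begin

end

theory Submission imports Defs "HOL-Real_Asymp.Real_Asymp"
begin

text \<open>
  Sample $t$ along a sequence $s_n \to \infty$ (powers of $2$ for the polynomial case, integers for the
  exponential case) sparse enough that $\sum_n F(s_{n+1}) / g(s_n) < \infty$ for the target growth
  function $g$, yet dense enough that monotonicity of $f(x;\cdot)$ and $g$ fills the gaps. By monotone
  convergence $\sum_n f(x; s_{n+1}) / g(s_n)$ is finite almost everywhere, so its terms are bounded.
\<close>

text \<open>A first-moment argument in the style of Borel-Cantelli. Passing to
  \<open>ennreal\<close> lets the pointwise series be formed and integrated termwise before anything
  is known about its convergence.\<close>

lemma AE_bounded_if_summable_integrals:
  fixes h :: "nat \<Rightarrow> 'a \<Rightarrow> real"
  assumes int: "\<And>n. integrable M (h n)"
    and nonneg: "\<And>n x. x \<in> space M \<Longrightarrow> h n x \<ge> 0"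
    and sum: "summable (\<lambda>n. \<integral>x. h n x \<partial>M)"
  shows "AE x in M. \<exists>C. \<forall>n. h n x \<le> C"
proof -
  have meas [measurable]: "(\<lambda>x. ennreal (h n x)) \<in> borel_measurable M" for n
    using int[of n] by measurable
  have "(\<integral>\<^sup>+x. (\<Sum>n. ennreal (h n x)) \<partial>M) = (\<Sum>n. \<integral>\<^sup>+x. ennreal (h n x) \<partial>M)"
    using meas by (rule nn_integral_suminf)
  also have "\<dots> = (\<Sum>n. ennreal (\<integral>x. h n x \<partial>M))"
    using int nonneg by (intro suminf_cong nn_integral_eq_integral) auto
  also have "\<dots> = ennreal (\<Sum>n. \<integral>x. h n x \<partial>M)"
    using sum nonneg by (intro suminf_ennreal2 Bochner_Integration.integral_nonneg) auto
  finally have fin: "(\<integral>\<^sup>+x. (\<Sum>n. ennreal (h n x)) \<partial>M) \<noteq> \<infinity>" by simp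
  have "AE x in M. (\<Sum>n. ennreal (h n x)) \<noteq> \<infinity>"
    using fin by (intro nn_integral_PInf_AE) simp_all
  then show ?thesis
  proof eventually_elim
    case (elim x)
    \<comment> \<open>The bound is the sum of the whole series. Finiteness at \<open>x\<close>
      matters here, since \<open>enn2real\<close> sends infinity to 0.\<close>
    have "h n x \<le> enn2real (\<Sum>n. ennreal (h n x))" for n
    proof -
      have "ennreal (h n x) \<le> (\<Sum>n. ennreal (h n x))"
        using sum_le_suminf[of "\<lambda>n. ennreal (h n x)" "{n}"] by simp
      also have "\<dots> = ennreal (enn2real (\<Sum>n. ennreal (h n x)))"
        using elim by (simp add: top.not_eq_extremum)
      finally show ?thesis by (simp add: ennreal_le_iff)
    qed
    then show ?case by blast
  qed
qed

text \<open>Serves both growth rates: \<open>G\<close> is the known rate of the integral,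
  \<open>g\<close> the slightly larger target. The index shift in \<open>summ\<close> is the price
  of filling gaps: between two samples, \<open>f x\<close> is rounded up to the right sample and
  \<open>g\<close> down to the left one.\<close>

lemma AE_bigo_by_sampling:
  fixes f :: "'a \<Rightarrow> real \<Rightarrow> real" and F G g :: "real \<Rightarrow> real" and s :: "nat \<Rightarrow> real"
  assumes int: "\<And>t. t > 0 \<Longrightarrow> integrable M (\<lambda>x. f x t)"
    and nonneg: "\<And>x t. x \<in> space M \<Longrightarrow> t > 0 \<Longrightarrow> f x t \<ge> 0"
    and mono: "\<And>x. x \<in> space M \<Longrightarrow> mono_on {0<..} (f x)"
    and F: "\<And>t. t > 0 \<Longrightarrow> F t = (\<integral>x. f x t \<partial>M)"
    and bigo: "F \<in> O[at_top](G)"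
    and s_pos: "\<And>n. s n > 0"
    and s_lim: "filterlim s at_top sequentially"
    and g_pos: "\<And>t. t > 0 \<Longrightarrow> g t > 0"
    and g_mono: "mono_on {0<..} g"
    and summ: "summable (\<lambda>n. norm (G (s (Suc n)) / g (s n)))"
  shows "AE x in M. f x \<in> O[at_top](g)"
proof -
  have "(\<lambda>n. F (s (Suc n))) \<in> O(\<lambda>n. G (s (Suc n)))"
    using bigo s_lim
    by (intro landau_o.big.compose[OF bigo]) (simp add: filterlim_sequentially_Suc)
  then have "(\<lambda>n. F (s (Suc n)) / g (s n)) \<in> O(\<lambda>n. G (s (Suc n)) / g (s n))"
    using g_pos[OF s_pos] by (intro landau_o.big.divide_right) (auto simp: less_imp_neq[symmetric])
  then have "summable (\<lambda>n. F (s (Suc n)) / g (s n))"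
    using summ by (rule summable_comparison_test_bigo[rotated])
  then have "summable (\<lambda>n. \<integral>x. f x (s (Suc n)) / g (s n) \<partial>M)"
    by (simp add: F s_pos)
  moreover have "0 \<le> f x (s (Suc n)) / g (s n)" if "x \<in> space M" for x n
    using nonneg[OF that s_pos] g_pos[OF s_pos] by (simp add: less_imp_le)
  ultimately have "AE x in M. \<exists>C. \<forall>n. f x (s (Suc n)) / g (s n) \<le> C"
    using int[OF s_pos]
    by (intro AE_bounded_if_summable_integrals[where h = "\<lambda>n x. f x (s (Suc n)) / g (s n)"]) auto
  with AE_space show ?thesis
  proof eventually_elim
    case (elim x)
    then obtain C where C: "\<And>n. f x (s (Suc n)) / g (s n) \<le> C" by blast
    \<comment> \<open>A nonnegative \<open>C\<close> is needed below to multiply the inequality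
      \<open>g (s n) \<le> g t\<close> by it.\<close>
    have "0 \<le> f x (s (Suc 0)) / g (s 0)"
      using nonneg[OF elim(1) s_pos] g_pos[OF s_pos] by (simp add: less_imp_le)
    with C[of 0] have C0: "C \<ge> 0" by linarith
    have "norm (f x t) \<le> C * norm (g t)" if t: "t \<ge> s 0" for t
    proof -
      \<comment> \<open>Since \<open>s\<close> is not assumed monotone, the gap containing
        \<open>t\<close> is found through the least \<open>m\<close> with \<open>t < s m\<close>. As
        \<open>s 0 \<le> t\<close>, this \<open>m\<close> has a predecessor, and minimality puts its
        sample at or below \<open>t\<close>.\<close>
      from s_lim have "\<exists>m. t < s m"
        by (auto simp: filterlim_at_top_dense eventually_sequentially)
      then obtain m where m: "t < s m" "\<And>k. k < m \<Longrightarrow> \<not> t < s k"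
        using exists_least_iff[of "\<lambda>m. t < s m"] by blast
      with t obtain n where n: "m = Suc n" by (cases m) auto
      with m have sn: "s n \<le> t" "t < s (Suc n)" by (auto simp: not_less)
      have t0: "t > 0" using t s_pos[of 0] by linarith
      have "f x t \<le> f x (s (Suc n))"
        using mono_onD[OF mono[OF elim(1)]] t0 sn s_pos by simp
      also have "\<dots> \<le> C * g (s n)"
        using C[of n] g_pos[OF s_pos[of n]] by (simp add: pos_divide_le_eq)
      also have "\<dots> \<le> C * g t"
        using mono_onD[OF g_mono, of "s n" t] sn s_pos[of n] t0 C0
        by (intro mult_left_mono) auto
      finally show ?thesis using nonneg[OF elim(1) t0] g_pos[OF t0] by simp
    qed
    then show ?case
      by (intro bigoI[of _ C] eventually_at_top_linorderI)
  qed
qed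

theorem proposition3:
  fixes M :: "'a measure"
    and f :: "'a \<Rightarrow> real \<Rightarrow> real"
    and F :: "real \<Rightarrow> real"
    and \<epsilon> :: real
  assumes "finite_measure M"
    and "\<And>t. t > 0 \<Longrightarrow> integrable M (\<lambda>x. f x t)"
    and "\<And>x t. x \<in> space M \<Longrightarrow> t > 0 \<Longrightarrow> f x t \<ge> 0"
    and "\<And>x. x \<in> space M \<Longrightarrow> mono_on {0<..} (f x)"
    and "\<And>t. t > 0 \<Longrightarrow> F t = (\<integral>x. f x t \<partial>M)"
    and "filterlim F at_top at_top"
    and "\<epsilon> > 0"
  shows "(\<forall>p>0. F \<in> O[at_top](\<lambda>t. t powr p) \<longrightarrow>
            (AE x in M. f x \<in> O[at_top](\<lambda>t. t powr (p + \<epsilon>)))) \<and>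
         (\<forall>a>0. F \<in> O[at_top](\<lambda>t. exp (a * t)) \<longrightarrow>
            (AE x in M. f x \<in> O[at_top](\<lambda>t. exp ((a + \<epsilon>) * t))))"
proof (intro conjI allI impI)
  fix p :: real
  assume p: "p > 0" and bigo: "F \<in> O[at_top](\<lambda>t. t powr p)"
  \<comment> \<open>The exponent of 2 is (n+1)p - n(p + \<epsilon>) = p - n\<epsilon>, so the series
    is geometric. Integer samples would give terms of order n^(-\<epsilon>), which are not summable
    for \<epsilon> \<le> 1.\<close>
  have "norm ((2 ^ Suc n) powr p / (2 ^ n) powr (p + \<epsilon>)) = 2 powr p * (2 powr - \<epsilon>) ^ n" for n :: nat
    by (simp add: powr_realpow[symmetric] powr_powr powr_add[symmetric] powr_diff[symmetric]
        powr_mult algebra_simps)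
  moreover have "summable (\<lambda>n. 2 powr p * (2 powr - \<epsilon>) ^ n)"
    using \<open>\<epsilon> > 0\<close> powr_less_mono[of "- \<epsilon>" 0 2] by (intro summable_mult summable_geometric) simp
  ultimately have "summable (\<lambda>n. norm ((2 ^ Suc n) powr p / (2 ^ n) powr (p + \<epsilon>)))"
    by simp
  moreover have "filterlim (\<lambda>n. 2 ^ n :: real) at_top sequentially"
    by real_asymp
  moreover have "mono_on {0<..} (\<lambda>t. t powr (p + \<epsilon>))"
    using p \<open>\<epsilon> > 0\<close> by (intro mono_onI powr_mono2) auto
  ultimately show "AE x in M. f x \<in> O[at_top](\<lambda>t. t powr (p + \<epsilon>))"
    by (intro AE_bigo_by_sampling[OF assms(2-5) bigo, where s = "\<lambda>n. 2 ^ n"]) auto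
next
  fix a :: real
  assume a: "a > 0" and bigo: "F \<in> O[at_top](\<lambda>t. exp (a * t))"
  \<comment> \<open>The exponent is a(n+2) - (a + \<epsilon>)(n+1) = a - \<epsilon> - n\<epsilon>,
    again geometric; samples start at 1 to stay positive. Powers of 2 would give exp((a -
    \<epsilon>) 2^n), not summable for \<epsilon> \<le> a.\<close>
  have "norm (exp (a * real (Suc (Suc n))) / exp ((a + \<epsilon>) * real (Suc n)))
      = exp (a - \<epsilon>) * exp (- \<epsilon>) ^ n" for n
    by (simp add: exp_of_nat_mult[symmetric] exp_add[symmetric] exp_diff[symmetric] algebra_simps)
  moreover have "summable (\<lambda>n. exp (a - \<epsilon>) * exp (- \<epsilon>) ^ n)"
    using \<open>\<epsilon> > 0\<close> by (intro summable_mult summable_geometric) simp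
  ultimately have "summable (\<lambda>n. norm (exp (a * real (Suc (Suc n))) / exp ((a + \<epsilon>) * real (Suc n))))"
    by simp
  moreover have "filterlim (\<lambda>n. real (Suc n)) at_top sequentially"
    using filterlim_real_sequentially by (simp only: filterlim_sequentially_Suc)
  moreover have "mono_on {0<..} (\<lambda>t. exp ((a + \<epsilon>) * t))"
    using a \<open>\<epsilon> > 0\<close> by (intro mono_onI) auto
  ultimately show "AE x in M. f x \<in> O[at_top](\<lambda>t. exp ((a + \<epsilon>) * t))"
    by (intro AE_bigo_by_sampling[OF assms(2-5) bigo, where s = "\<lambda>n. real (Suc n)"]) auto
qed

end
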